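(* Let $\mathbf{A} \in \mathbb{R}^{n\times n}$ be a nonsingular matrix, let $\bm{b} \in \mathbb{R}^n$, and let $\bm{x}^{\star} = \mathbf{A}^{-1}\bm{b}$ be the exact solution of $\mathbf{A}\bm{x} = \bm{b}$. Let $\mathbf{A} = \mathbf{U}\mathbf{\Sigma}\mathbf{V}^{t}$ be a singular value decomposition of $\mathbf{A}$, with $\mathbf{U}, \mathbf{V} \in \mathbb{R}^{n\times n}$ orthogonal and $\mathbf{\Sigma} = \mathrm{diag}(\sigma_1,\dots,\sigma_n)$, $\sigma_1 \geq \sigma_2 \geq \cdots \geq \sigma_n > 0$. Let $(\alpha_k)_{k\ge 0}$ be a sequence of real numbers. For every $\gamma > 0$ and any initial datum $\bm{x}^{[0]}_{\gamma} \in \mathbb{R}^n$, let the sequence $\{\bm{x}^{[k]}_{\gamma}\}$ be generated by the stabilized gradient method $$\left(\mathbf{I} + \gamma\mathbf{A}^{t}\mathbf{A}\right)\bm{x}^{[k+1]}_{\gamma} = \left(\mathbf{I} - \alpha_{k}\mathbf{A}\right)\bm{x}^{[k]}_{\gamma} + \alpha_{k}\bm{b} + \gamma\mathbf{A}^{t}\bm{b}, \quad k = 0, 1, 2, \ldots$$ Then: (i) For stepsizes $\alpha_k$ that may vary with $k$, $$\|\bm{x}^{[k]}_{\gamma} - \bm{x}^{\star}\|_{n} \leq \left(\frac{\kappa(\mathbf{V})}{1 + \gamma\sigma^{2}_{n}}\right)^{k}\left(\prod_{i=0}^{k-1}\left\|\mathbf{I} - \alpha_{i}\mathbf{A}\right\|\right)\|\bm{x}^{[0]}_{\gamma}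 - \bm{x}^{\star}\|_{n} \quad \text{for all } \gamma > 0 \text{ and all integers } k \geq 1.$$ (ii) If the stepsize is constant, i.e. $\alpha_k = \alpha$ for all $k$, then $$\|\bm{x}^{[k]}_{\gamma} - \bm{x}^{\star}\|_{n} \leq \left(\left(\frac{\kappa(\mathbf{V})}{1 + \gamma\sigma^{2}_{n}}\right)\left\|\mathbf{I} - \alpha\mathbf{A}\right\|\right)^{k}\|\bm{x}^{[0]}_{\gamma} - \bm{x}^{\star}\|_{n} \quad \text{for all } \gamma > 0 \text{ and all integers } k \geq 1.$$
   Context: $\|\cdot\|_{n}$ denotes the Euclidean vector norm on $\mathbb{R}^n$, and $\|\cdot\|$ the matrix norm induced by it. $\mathbf{I}$ is the identity matrix and $\mathbf{A}^t$ is the transpose of $\mathbf{A}$. $\kappa(\mathbf{V}) = \|\mathbf{V}\|\,\|\mathbf{V}^{-1}\|$ is the condition number of $\mathbf{V}$. The matrix $\mathbf{I} + \gamma\mathbf{A}^{t}\mathbf{A}$ is invertible for every $\gamma > 0$, so the iteration is well defined. *)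

theory Defs
  imports "HOL-Analysis.Analysis"
begin

text \<open>
  Vectors in \<open>\<real>\<^sup>n\<close> are of type \<open>real ^ 'n\<close>. The index type is linearly ordered, so that
  indices \<open>1 < \<dots> < n\<close> and the decreasing arrangement of the singular values make sense.
\<close>

text \<open>
  The matrix norm induced by the Euclidean norm. The type-class \<open>norm\<close> of a matrix in
  \<open>real ^ 'n ^ 'n\<close> is its Frobenius norm, not this one.
\<close>

definition op_norm :: "real ^ 'n ^ 'n \<Rightarrow> real" where
  "op_norm M = onorm (\<lambda>v. M *v v)"

definition cond_num :: "real ^ 'n ^ 'n \<Rightarrow> real" where
  "cond_num M = op_norm M * op_norm (matrix_inv M)"

definition diag_mat :: "real ^ 'n \<Rightarrow> real ^ 'n ^ 'n" where
  "diag_mat d = (\<chi> i j. if i = j then d $ i else 0)"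

text \<open>
  Singular value decomposition \<open>A = U \<Sigma> V\<^sup>t\<close> with \<open>\<Sigma> = diag \<sigma>\<close>, the entries of \<open>\<sigma>\<close> being
  positive and in decreasing order (so \<open>A\<close> is nonsingular).
\<close>

definition is_pos_svd ::
  "real ^ ('n::{finite,linorder}) ^ ('n::_) \<Rightarrow> real ^ ('n::_) ^ ('n::_) \<Rightarrow>
   real ^ ('n::_) \<Rightarrow> real ^ ('n::_) ^ ('n::_) \<Rightarrow> bool" where
  "is_pos_svd A U \<sigma> V \<longleftrightarrow>
     orthogonal_matrix U \<and> orthogonal_matrix V \<and>
     (\<forall>i j. i \<le> j \<longrightarrow> \<sigma> $ j \<le> \<sigma> $ i) \<and> (\<forall>i. 0 < \<sigma> $ i) \<and>
     A = U ** diag_mat \<sigma> ** transpose V"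

text \<open>
  \<open>x\<close> is generated by the stabilized gradient method with parameter \<open>\<gamma>\<close> and stepsizes \<open>\<alpha>\<close>,
  from the (arbitrary) initial datum \<open>x 0\<close>. For \<open>\<gamma> > 0\<close> the matrix on the left is invertible,
  so the recurrence determines \<open>x\<close> from \<open>x 0\<close>.
\<close>

definition stabilized_gradient ::
  "real ^ 'n ^ 'n \<Rightarrow> real ^ 'n \<Rightarrow> (nat \<Rightarrow> real) \<Rightarrow> real \<Rightarrow> (nat \<Rightarrow> real ^ 'n) \<Rightarrow> bool" where
  "stabilized_gradient A b \<alpha> \<gamma> x \<longleftrightarrow>
     (\<forall>k. (mat 1 + \<gamma> *\<^sub>R (transpose A ** A)) *v x (Suc k) =
          (mat 1 - \<alpha> k *\<^sub>R A) *v x k + \<alpha> k *\<^sub>R b + \<gamma> *\<^sub>R (transpose A *v b))"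

end

theory Submission
  imports Defs
begin

text \<open>
  Since \<open>b = A xstar\<close>, the term \<open>\<gamma> A\<^sup>t b\<close> cancels against the regularization of \<open>xstar\<close>, and the
  errors \<open>e k = x k - xstar\<close> obey the homogeneous recurrence
  \<open>(I + \<gamma> A\<^sup>t A) e (k + 1) = (I - \<alpha> k A) e k\<close>. The singular value decomposition supplies the
  lower bound \<open>\<parallel>A v\<parallel> \<ge> \<sigma>\<^sub>n \<parallel>v\<parallel>\<close>, because the orthogonal factors preserve norms. This
  makes the left-hand matrix expansive: \<open>\<langle>w, (I + \<gamma> A\<^sup>t A) w\<rangle> = \<parallel>w\<parallel>\<^sup>2 + \<gamma> \<parallel>A w\<parallel>\<^sup>2\<close> is
  at least \<open>(1 + \<gamma> \<sigma>\<^sub>n\<^sup>2) \<parallel>w\<parallel>\<^sup>2\<close>, so by Cauchy--Schwarz it stretches every vector by at least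
  \<open>1 + \<gamma> \<sigma>\<^sub>n\<^sup>2\<close> (lemma \<open>regularized_gram_expansive\<close>).

  Each step therefore multiplies the error by at most \<open>\<parallel>I - \<alpha> k A\<parallel> / (1 + \<gamma> \<sigma>\<^sub>n\<^sup>2)\<close>. The condition
  number of an invertible matrix is at least \<open>1\<close>, which allows the factor \<open>\<kappa>(V)\<close> to be inserted. Iterating over \<open>k\<close> gives the
  bound for variable stepsizes, and for constant stepsizes the product is a power.
\<close>

lemma norm_matrix_vector_le_op_norm: "norm (M *v v) \<le> op_norm M * norm v"
  unfolding op_norm_def by (rule onorm[OF matrix_vector_mul_bounded_linear])

lemma op_norm_nonneg: "0 \<le> op_norm M"
  unfolding op_norm_def by (rule onorm_pos_le[OF matrix_vector_mul_bounded_linear])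

lemma matrix_inv_inverse:
  assumes "invertible M"
  shows "M ** matrix_inv M = mat 1" and "matrix_inv M ** M = mat 1"
  using assms unfolding invertible_def matrix_inv_def by (metis (mono_tags, lifting) someI_ex)+

text \<open>
  A unit vector \<open>v\<close> has norm \<open>1 = \<parallel>M\<^sup>-\<^sup>1 (M v)\<parallel>\<close>, which submultiplicativity bounds by the condition
  number.
\<close>

lemma cond_num_ge_1:
  assumes "invertible M"
  shows "1 \<le> cond_num M"
proof -
  let ?v = "axis undefined 1 :: real ^ 'a"
  have "1 = norm (matrix_inv M *v (M *v ?v))"
    using assms by (simp add: matrix_vector_mul_assoc matrix_inv_inverse)
  also have "\<dots> \<le> op_norm (matrix_inv M) * norm (M *v ?v)"
    by (rule norm_matrix_vector_le_op_norm)
  also have "\<dots> \<le> op_norm (matrix_inv M) * (op_norm M * norm ?v)"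
    by (intro mult_left_mono norm_matrix_vector_le_op_norm op_norm_nonneg)
  finally show ?thesis
    by (simp add: cond_num_def mult.commute)
qed

lemma norm_orthogonal_matrix_vector:
  fixes Q :: "real ^ 'n ^ 'n"
  assumes "orthogonal_matrix Q"
  shows "norm (Q *v v) = norm v"
proof -
  have "(Q *v v) \<bullet> (Q *v v) = v \<bullet> v"
    using assms
    by (metis dot_lmul_matrix orthogonal_matrix matrix_vector_mul_assoc matrix_vector_mul_lid
        transpose_matrix_vector vector_transpose_matrix inner_commute)
  then show ?thesis
    by (simp add: norm_eq)
qed

lemma norm_diag_mat_ge:
  assumes "0 \<le> s" and "\<And>i. s \<le> d $ i"
  shows "s * norm y \<le> norm (diag_mat d *v y)"
proof -
  have component: "(diag_mat d *v y) $ i = d $ i * y $ i" for i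
    by (simp add: diag_mat_def matrix_vector_mult_def if_distrib[of "\<lambda>z. z * _"] cong: if_cong)
  have "norm (s *\<^sub>R y) \<le> norm (diag_mat d *v y)"
  proof (rule norm_le_componentwise_cart)
    fix i
    have "\<bar>s\<bar> \<le> \<bar>d $ i\<bar>"
      using assms(1) assms(2)[of i] by simp
    then show "norm ((s *\<^sub>R y) $ i) \<le> norm ((diag_mat d *v y) $ i)"
      by (simp add: component abs_mult mult_right_mono)
  qed
  then show ?thesis
    using assms(1) by simp
qed

lemma least_singular_value_bound:
  assumes "is_pos_svd A U \<sigma> V"
  shows "\<sigma> $ Max UNIV * norm v \<le> norm (A *v v)"
proof -
  have U: "orthogonal_matrix U" and V: "orthogonal_matrix (transpose V)"
    and A: "A = U ** diag_mat \<sigma> ** transpose V"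
    using assms by (simp_all add: is_pos_svd_def)
  have "norm (A *v v) = norm (diag_mat \<sigma> *v (transpose V *v v))"
    unfolding A by (simp add: norm_orthogonal_matrix_vector[OF U] flip: matrix_vector_mul_assoc)
  moreover have "\<sigma> $ Max UNIV * norm (transpose V *v v) \<le> \<dots>"
    using assms by (intro norm_diag_mat_ge) (auto simp: is_pos_svd_def less_imp_le)
  ultimately show ?thesis
    by (simp only: norm_orthogonal_matrix_vector[OF V])
qed

text \<open>
  Pairing \<open>(I + \<gamma> A\<^sup>t A) w\<close> with \<open>w\<close> turns the Gram matrix into \<open>\<parallel>A w\<parallel>\<^sup>2\<close>, so a lower bound on \<open>A\<close>
  yields one on the regularized matrix without inverting it.
\<close>

lemma regularized_gram_expansive:
  fixes A :: "real ^ 'n ^ 'n"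
  assumes "0 \<le> \<gamma>" "0 \<le> s" and lower: "s * norm w \<le> norm (A *v w)"
  shows "(1 + \<gamma> * s\<^sup>2) * norm w \<le> norm ((mat 1 + \<gamma> *\<^sub>R (transpose A ** A)) *v w)"
    (is "_ \<le> norm (?M *v w)")
proof (cases "w = 0")
  case False
  have gram: "w \<bullet> (transpose A *v (A *v w)) = (norm (A *v w))\<^sup>2"
    by (metis dot_lmul_matrix inner_commute power2_norm_eq_inner vector_transpose_matrix)
  have "(s * norm w)\<^sup>2 \<le> (norm (A *v w))\<^sup>2"
    using assms by (intro power_mono) auto
  then have "\<gamma> * (s\<^sup>2 * (norm w)\<^sup>2) \<le> \<gamma> * (norm (A *v w))\<^sup>2"
    using assms(1) by (simp add: mult_left_mono power_mult_distrib)
  then have "(1 + \<gamma> * s\<^sup>2) * (norm w)\<^sup>2 \<le> (norm w)\<^sup>2 + \<gamma> * (norm (A *v w))\<^sup>2"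
    by (simp add: algebra_simps)
  also have "\<dots> = w \<bullet> (?M *v w)"
    by (simp add: matrix_vector_mult_add_rdistrib inner_add_right gram dot_square_norm
        flip: matrix_vector_mul_assoc scaleR_matrix_vector_assoc
        del: transpose_matrix_vector)
  also have "\<dots> \<le> norm w * norm (?M *v w)"
    by (rule norm_cauchy_schwarz)
  finally have "norm w * ((1 + \<gamma> * s\<^sup>2) * norm w) \<le> norm w * norm (?M *v w)"
    by (simp add: power2_eq_square algebra_simps)
  with False show ?thesis
    by simp
qed simp

lemma stabilized_gradient_error:
  assumes "stabilized_gradient A b \<alpha> \<gamma> x" and b: "A *v xstar = b"
  shows "(mat 1 + \<gamma> *\<^sub>R (transpose A ** A)) *v (x (Suc k) - xstar) =
         (mat 1 - \<alpha> k *\<^sub>R A) *v (x k - xstar)"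
proof -
  have "(mat 1 + \<gamma> *\<^sub>R (transpose A ** A)) *v xstar = xstar + \<gamma> *\<^sub>R (transpose A *v b)"
    and "(mat 1 - \<alpha> k *\<^sub>R A) *v xstar = xstar - \<alpha> k *\<^sub>R b"
    by (simp_all add: matrix_vector_mult_add_rdistrib matrix_vector_mult_diff_rdistrib b
        flip: matrix_vector_mul_assoc scaleR_matrix_vector_assoc)
  with assms(1) show ?thesis
    by (simp add: stabilized_gradient_def matrix_vector_mult_diff_distrib)
qed

lemma norm_le_prod_of_step_bounds:
  fixes e :: "nat \<Rightarrow> 'a::real_normed_vector" and c :: real and L :: "nat \<Rightarrow> real"
  assumes "\<And>k. norm (e (Suc k)) \<le> c * L k * norm (e k)"
    and "0 \<le> c" and "\<And>k. 0 \<le> L k"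
  shows "norm (e k) \<le> c ^ k * (\<Prod>i<k. L i) * norm (e 0)"
proof (induction k)
  case (Suc k)
  have "norm (e (Suc k)) \<le> c * L k * norm (e k)"
    by (rule assms(1))
  also have "\<dots> \<le> c * L k * (c ^ k * (\<Prod>i<k. L i) * norm (e 0))"
    using Suc assms(2,3) by (intro mult_left_mono) auto
  finally show ?case
    by (simp add: algebra_simps)
qed simp

theorem corollary1:
  fixes A U V :: "real ^ ('n::{finite,linorder}) ^ ('n::_)"
    and \<sigma> b xstar :: "real ^ ('n::_)"
    and \<alpha> :: "nat \<Rightarrow> real"
    and x :: "real \<Rightarrow> nat \<Rightarrow> real ^ ('n::_)"
  assumes "invertible A"
    and "xstar = matrix_inv A *v b"
    and "is_pos_svd A U \<sigma> V"
    and "\<And>\<gamma>. \<gamma> > 0 \<Longrightarrow> stabilized_gradient A b \<alpha> \<gamma> (x \<gamma>)"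
  shows "(\<forall>\<gamma>>0. \<forall>k\<ge>1.
            norm (x \<gamma> k - xstar)
              \<le> (cond_num V / (1 + \<gamma> * (\<sigma> $ Max UNIV)\<^sup>2)) ^ k
                 * (\<Prod>i<k. op_norm (mat 1 - \<alpha> i *\<^sub>R A)) * norm (x \<gamma> 0 - xstar)) \<and>
         (\<forall>a. (\<forall>k. \<alpha> k = a) \<longrightarrow>
            (\<forall>\<gamma>>0. \<forall>k\<ge>1.
              norm (x \<gamma> k - xstar)
                \<le> (cond_num V / (1 + \<gamma> * (\<sigma> $ Max UNIV)\<^sup>2) * op_norm (mat 1 - a *\<^sub>R A)) ^ k
                   * norm (x \<gamma> 0 - xstar)))"
proof -
  let ?s = "\<sigma> $ Max UNIV"
  let ?L = "\<lambda>k. op_norm (mat 1 - \<alpha> k *\<^sub>R A)"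
  have s: "0 \<le> ?s" and "orthogonal_matrix V"
    using assms(3) by (auto simp: is_pos_svd_def less_imp_le)
  then have cond: "1 \<le> cond_num V"
    by (auto intro!: cond_num_ge_1 simp: invertible_def orthogonal_matrix_def)
  have b: "A *v xstar = b"
    using assms(1,2) by (simp add: matrix_vector_mul_assoc matrix_inv_inverse)
  have bound: "norm (x \<gamma> k - xstar)
      \<le> (cond_num V / (1 + \<gamma> * ?s\<^sup>2)) ^ k * (\<Prod>i<k. ?L i) * norm (x \<gamma> 0 - xstar)"
    if "\<gamma> > 0" for \<gamma> k
  proof (rule norm_le_prod_of_step_bounds)
    have pos: "0 < 1 + \<gamma> * ?s\<^sup>2"
      using \<open>\<gamma> > 0\<close> by (simp add: add_pos_nonneg)
    fix k
    let ?e = "\<lambda>k. x \<gamma> k - xstar"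
    have "(1 + \<gamma> * ?s\<^sup>2) * norm (?e (Suc k))
        \<le> norm ((mat 1 + \<gamma> *\<^sub>R (transpose A ** A)) *v ?e (Suc k))"
      using \<open>\<gamma> > 0\<close> s least_singular_value_bound[OF assms(3)]
      by (intro regularized_gram_expansive) auto
    also have "\<dots> = norm ((mat 1 - \<alpha> k *\<^sub>R A) *v ?e k)"
      by (simp only: stabilized_gradient_error[OF assms(4)[OF \<open>\<gamma> > 0\<close>] b])
    also have "\<dots> \<le> ?L k * norm (?e k)"
      by (rule norm_matrix_vector_le_op_norm)
    also have "\<dots> \<le> cond_num V * (?L k * norm (?e k))"
      using cond mult_right_mono[OF cond, of "?L k * norm (?e k)"] by (simp add: op_norm_nonneg)
    finally show "norm (?e (Suc k)) \<le> cond_num V / (1 + \<gamma> * ?s\<^sup>2) * ?L k * norm (?e k)"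
      using pos by (simp add: pos_le_divide_eq mult_ac)
    show "0 \<le> cond_num V / (1 + \<gamma> * ?s\<^sup>2)"
      using cond pos by simp
  qed (rule op_norm_nonneg)
  show ?thesis
  proof (intro conjI allI impI)
    fix a \<gamma> :: real and k :: nat
    assume "\<forall>k. \<alpha> k = a" and "\<gamma> > 0"
    with bound[of \<gamma> k] show "norm (x \<gamma> k - xstar)
        \<le> (cond_num V / (1 + \<gamma> * ?s\<^sup>2) * op_norm (mat 1 - a *\<^sub>R A)) ^ k * norm (x \<gamma> 0 - xstar)"
      by (simp only: prod_constant card_lessThan power_mult_distrib)
  qed (rule bound)
qed

end
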